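(* Let $N=|X\setminus A|$, let $\nu$ be a finite positive Borel measure on $\mathbb T^{N}$, and let $\mathcal H_\nu$ be the associated reproducing kernel Hilbert space on $K(X,A)$. Then every $f\in\mathcal H_\nu$ satisfies $$\mathrm{Lip}(f)\;\le\;\|f\|_{\mathcal H_\nu}\left(\int_{\mathbb T^{N}}\mathrm{Lip}(\chi_\theta)^2\,d\nu(\theta)\right)^{1/2}.$$
   Context: Lipschitz seminorm: for a map $f:(M_1,\rho_1)\to(M_2,\rho_2)$ of metric spaces, $\mathrm{Lip}(f):=\sup_{\alpha\ne\beta}\rho_2(f(\alpha),f(\beta))/\rho_1(\alpha,\beta)\in[0,\infty]$. Setting: $(X,d)$ is a metric space and $A\subseteq X$ is nonempty with $X\setminus A=\{x_1,\dots,x_N\}$ finite, $N\ge1$. Write $d(x,A)=\inf_{a\in A}d(x,a)$ and $d_1(x,y):=\min\{d(x,y),\,d(x,A)+d(y,A)\}$. Let $X/A=\{[A],x_1,\dots,x_N\}$ be the quotient collapsing $A$ to the basepoint $[A]$, and let $\overline d_1$ be the function on $X/A$ induced by $d_1$; it is assumed to be a metric on $X/A$ (equivalently $d(x_j,A)>0$ for all $j$). Diagrams: $D(X,A)$ is the free commutative monoid on $X\setminus A$ (finite multisets of points of $X\setminus A$; the point $[A]$ is identified with $0$). For $\alpha,\beta\in D(X,A)$, $W_1(\alpha,\beta)$ is the infimum of $\sum_{i}\overline d_1(u_i,v_i)$ over all finite multisets $\{(u_i,v_i)\}_i$ of pairs in $(X/A)\times(X/A)$ such that $\sum_i u_i$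 equals $\alpha$ and $\sum_i v_i$ equals $\beta$ modulo multiples of $[A]$. $K(X,A)$ is the Grothendieck group of $D(X,A)$, identified with the free abelian group $\mathbb Z^{N}$ with basis $e_1,\dots,e_N$, where $e_j$ is the class of $x_j$. It carries the translation-invariant metric $\rho(a-b,c-e):=W_1(a+e,c+b)$ for $a,b,c,e\in D(X,A)$. Characters: $\mathbb T^{N}=\mathbb R^{N}/2\pi\mathbb Z^{N}$. For $\theta\in\mathbb T^N$, $\chi_\theta:K(X,A)\to S^1\subset\mathbb C$ is $\chi_\theta(\sum_j n_je_j)=\exp(i\sum_j n_j\theta_j)$. $S^1$ carries the geodesic (shorter arc length) metric $\operatorname{dist}(e^{ia},e^{ib})=\inf_{k\in\mathbb Z}|a-b+2\pi k|$, and $\mathrm{Lip}(\chi_\theta)$ is taken with respect to $\rho$ and $\operatorname{dist}$. RKHS: $k_\nu(\alpha,\beta)=\int_{\mathbb T^N}\chi_\theta(\alpha-\beta)\,d\nu(\theta)$ for $\alpha,\beta\in K(X,A)$ is a positive definite kernel, and $\mathcal H_\nu$ is the reproducing kernel Hilbert space of complex-valued functions on $K(X,A)$ with kernel $k_\nu$ (so $f(\alpha)=\langle f,k_\nu(\cdot,\alpha)\rangle_{\mathcal H_\nu}$). For $f\in\mathcal H_\nu$, $\mathrm{Lip}(f)$ is taken with respect to $\rho$ and the usual metric on $\mathbb C$. *)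

theory Defs
  imports "HOL-Analysis.Analysis" "HOL-Library.Multiset"
begin

section \<open>Lipschitz seminorms\<close>

definition Lip :: "('a \<Rightarrow> 'a \<Rightarrow> real) \<Rightarrow> ('b \<Rightarrow> 'b \<Rightarrow> real) \<Rightarrow> ('a \<Rightarrow> 'b) \<Rightarrow> ennreal" where
  "Lip \<rho>1 \<rho>2 f = (SUP (\<alpha>, \<beta>) \<in> {(\<alpha>, \<beta>). \<alpha> \<noteq> \<beta>}. ennreal (\<rho>2 (f \<alpha>) (f \<beta>) / \<rho>1 \<alpha> \<beta>))"

definition ennreal_sqrt :: "ennreal \<Rightarrow> ennreal" where
  "ennreal_sqrt t = (if t = \<infinity> then \<infinity> else ennreal (sqrt (enn2real t)))"

section \<open>The pointed metric space \<open>X/A\<close>\<close>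

text \<open>The metric space \<open>X\<close> is the whole type \<open>'a\<close>. In \<open>X/A\<close> the basepoint \<open>[A]\<close> is
  \<open>None\<close>, and a point \<open>p\<close> outside \<open>A\<close> is \<open>Some p\<close>.\<close>

definition quot :: "'a set \<Rightarrow> 'a option set" where
  "quot A = insert None (Some ` (- A))"

definition proj :: "'a set \<Rightarrow> 'a \<Rightarrow> 'a option" where
  "proj A p = (if p \<in> A then None else Some p)"

definition d1 :: "'a::metric_space set \<Rightarrow> 'a \<Rightarrow> 'a \<Rightarrow> real" where
  "d1 A p q = min (dist p q) (infdist p A + infdist q A)"

definition rep :: "'a set \<Rightarrow> 'a option \<Rightarrow> 'a" where
  "rep A u = (case u of None \<Rightarrow> (SOME a. a \<in> A) | Some p \<Rightarrow> p)"

text \<open>The function on \<open>X/A\<close> induced by \<open>d1\<close>; independence of the representative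
  is \<open>d1bar_proj\<close> below.\<close>

definition d1bar :: "'a::metric_space set \<Rightarrow> 'a option \<Rightarrow> 'a option \<Rightarrow> real" where
  "d1bar A u v = d1 A (rep A u) (rep A v)"

lemma d1_cong_base:
  assumes "a \<in> A" "b \<in> A"
  shows "d1 A a q = d1 A b q" "d1 A q a = d1 A q b"
proof -
  have "d1 A c q = infdist q A \<and> d1 A q c = infdist q A" if "c \<in> A" for c
    using that infdist_le[of c A q] by (auto simp: d1_def dist_commute)
  then show "d1 A a q = d1 A b q" "d1 A q a = d1 A q b"
    using assms by auto
qed

lemma d1bar_proj:
  assumes "A \<noteq> {}"
  shows "d1bar A (proj A p) (proj A q) = d1 A p q"
proof -
  have s: "(SOME a. a \<in> A) \<in> A"
    using assms some_in_eq by blast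
  have L: "d1 A (rep A (proj A p)) q' = d1 A p q'" for q'
    using d1_cong_base(1)[OF s] by (simp add: rep_def proj_def)
  have R: "d1 A p' (rep A (proj A q)) = d1 A p' q" for p'
    using d1_cong_base(2)[OF s] by (simp add: rep_def proj_def)
  show ?thesis
    unfolding d1bar_def L R by simp
qed

section \<open>Diagrams and the Wasserstein distance\<close>

definition diagrams :: "'a set \<Rightarrow> 'a multiset set" where
  "diagrams A = {\<alpha>. set_mset \<alpha> \<subseteq> - A}"

text \<open>The reduction of a formal sum of points of \<open>X/A\<close> modulo multiples of \<open>[A]\<close>.\<close>

definition strip :: "'a option multiset \<Rightarrow> 'a multiset" where
  "strip M = image_mset the {#u \<in># M. u \<noteq> None#}"

definition couplings :: "'a set \<Rightarrow> 'a multiset \<Rightarrow> 'a multiset \<Rightarrow> ('a option \<times> 'a option) multiset set" where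
  "couplings A \<alpha> \<beta> = {P. set_mset P \<subseteq> quot A \<times> quot A
     \<and> strip (image_mset fst P) = \<alpha> \<and> strip (image_mset snd P) = \<beta>}"

definition cost :: "'a::metric_space set \<Rightarrow> ('a option \<times> 'a option) multiset \<Rightarrow> real" where
  "cost A P = (\<Sum>(u, v) \<in># P. d1bar A u v)"

definition W1 :: "'a::metric_space set \<Rightarrow> 'a multiset \<Rightarrow> 'a multiset \<Rightarrow> real" where
  "W1 A \<alpha> \<beta> = (INF P \<in> couplings A \<alpha> \<beta>. cost A P)"

section \<open>The Grothendieck group\<close>

text \<open>\<open>K(X,A)\<close> is \<open>int ^ 'n\<close>, where \<open>x :: 'n \<Rightarrow> 'a\<close> enumerates the complement of \<open>A\<close>;
  \<open>cls\<close> is the canonical monoid homomorphism from the diagrams.\<close>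

definition cls :: "('n \<Rightarrow> 'a) \<Rightarrow> 'a multiset \<Rightarrow> int ^ 'n::finite" where
  "cls x \<alpha> = (\<chi> j. int (count \<alpha> (x j)))"

definition pos_diagram :: "('n \<Rightarrow> 'a) \<Rightarrow> int ^ 'n::finite \<Rightarrow> 'a multiset" where
  "pos_diagram x u = (\<Sum>j\<in>UNIV. replicate_mset (nat (u $ j)) (x j))"

text \<open>\<open>\<rho>(a - b, c - e) = W1 (a + e) (c + b)\<close>, stated for the representation of a class as
  the difference of its positive and negative parts; \<open>rho_cls\<close> below gives the formula for
  arbitrary diagrams.\<close>

definition rho :: "'a::metric_space set \<Rightarrow> ('n \<Rightarrow> 'a) \<Rightarrow> int ^ 'n::finite \<Rightarrow> int ^ 'n \<Rightarrow> real" where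
  "rho A x u v =
     W1 A (pos_diagram x u + pos_diagram x (- v)) (pos_diagram x v + pos_diagram x (- u))"

lemma strip_simps [simp]:
  "strip {#} = {#}"
  "strip (add_mset None M) = strip M"
  "strip (add_mset (Some p) M) = add_mset p (strip M)"
  "strip (M + M') = strip M + strip M'"
  by (simp_all add: strip_def)

lemma in_strip: "p \<in># strip M \<longleftrightarrow> Some p \<in># M"
  by (induction M) (auto simp: strip_def)

lemma d1bar_nonneg: "0 \<le> d1bar A u v"
  by (simp add: d1bar_def d1_def infdist_nonneg)

lemma cost_nonneg: "0 \<le> cost A P"
  unfolding cost_def by (induction P) (auto simp: d1bar_nonneg)

lemma cost_bdd_below: "bdd_below (cost A ` S)"
  by (rule bdd_belowI2[of _ 0]) (rule cost_nonneg)

lemma couplings_nonempty: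
  assumes "\<alpha> \<in> diagrams A" "\<beta> \<in> diagrams A"
  shows "couplings A \<alpha> \<beta> \<noteq> {}"
proof -
  let ?P = "image_mset (\<lambda>p. (Some p, None)) \<alpha> + image_mset (\<lambda>p. (None, Some p)) \<beta>"
  have "strip (image_mset Some M) = M" "strip (image_mset (\<lambda>_. None) M) = {#}" for M :: "'a multiset"
    by (induction M) auto
  then have "?P \<in> couplings A \<alpha> \<beta>"
    using assms by (auto simp: couplings_def quot_def diagrams_def multiset.map_comp comp_def)
  then show ?thesis by blast
qed

lemma W1_add_point:
  assumes M: "Metric_space (quot A) (d1bar A)"
    and \<alpha>: "\<alpha> \<in> diagrams A" and \<beta>: "\<beta> \<in> diagrams A" and p: "p \<notin> A"
  shows "W1 A (add_mset p \<alpha>) (add_mset p \<beta>) = W1 A \<alpha> \<beta>"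
proof (rule antisym)
  have pq: "Some p \<in> quot A"
    using p by (auto simp: quot_def)
  then have d0: "d1bar A (Some p) (Some p) = 0"
    using Metric_space.mdist_zero[OF M] by blast
  show "W1 A (add_mset p \<alpha>) (add_mset p \<beta>) \<le> W1 A \<alpha> \<beta>"
    unfolding W1_def
  proof (rule cINF_greatest[OF couplings_nonempty[OF \<alpha> \<beta>]])
    fix P assume P: "P \<in> couplings A \<alpha> \<beta>"
    then have "add_mset (Some p, Some p) P \<in> couplings A (add_mset p \<alpha>) (add_mset p \<beta>)"
      using pq by (auto simp: couplings_def)
    moreover have "cost A (add_mset (Some p, Some p) P) = cost A P"
      by (simp add: cost_def d0)
    ultimately show "(INF P \<in> couplings A (add_mset p \<alpha>) (add_mset p \<beta>). cost A P) \<le> cost A P"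
      by (rule ord_le_eq_trans[OF cINF_lower[OF cost_bdd_below]])
  qed
  have ne: "couplings A (add_mset p \<alpha>) (add_mset p \<beta>) \<noteq> {}"
    by (rule couplings_nonempty) (use \<alpha> \<beta> p in \<open>auto simp: diagrams_def\<close>)
  show "W1 A \<alpha> \<beta> \<le> W1 A (add_mset p \<alpha>) (add_mset p \<beta>)"
    unfolding W1_def
  proof (rule cINF_greatest[OF ne])
    fix P assume P: "P \<in> couplings A (add_mset p \<alpha>) (add_mset p \<beta>)"
    then have sub: "set_mset P \<subseteq> quot A \<times> quot A"
      and f: "strip (image_mset fst P) = add_mset p \<alpha>"
      and s: "strip (image_mset snd P) = add_mset p \<beta>"
      by (auto simp: couplings_def)
    have "Some p \<in># image_mset fst P"
      unfolding in_strip[symmetric] f by simp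
    then obtain v where v: "(Some p, v) \<in># P"
      by (auto simp: image_iff)
    have "Some p \<in># image_mset snd P"
      unfolding in_strip[symmetric] s by simp
    then obtain u where u: "(u, Some p) \<in># P"
      by (auto simp: image_iff)
    have "\<exists>P' \<in> couplings A \<alpha> \<beta>. cost A P' \<le> cost A P"
    proof (cases "v = Some p")
      case True
      then obtain P' where P': "P = add_mset (Some p, Some p) P'"
        using v by (auto dest: multi_member_split)
      then have "P' \<in> couplings A \<alpha> \<beta>"
        using sub f s by (auto simp: couplings_def)
      moreover have "cost A P' = cost A P"
        by (simp add: P' cost_def d0)
      ultimately show ?thesis by (intro bexI[of _ P']) simp_all
    next
      case False
      obtain P1 where P1: "P = add_mset (Some p, v) P1"
        using v by (auto dest: multi_member_split)
      then have "(u, Some p) \<in># P1"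
        using u False by auto
      then obtain P2 where P2: "P1 = add_mset (u, Some p) P2"
        by (auto dest: multi_member_split)
      have uv: "u \<in> quot A" "v \<in> quot A"
        using sub by (auto simp: P1 P2)
      have "strip (add_mset u (image_mset fst P2)) = \<alpha>"
        using f by (simp add: P1 P2)
      moreover have "strip (image_mset snd P) = add_mset p (strip (add_mset v (image_mset snd P2)))"
        by (cases v) (simp_all add: P1 P2 add_mset_commute)
      then have "strip (add_mset v (image_mset snd P2)) = \<beta>"
        using s by simp
      ultimately have "add_mset (u, v) P2 \<in> couplings A \<alpha> \<beta>"
        using sub uv by (auto simp: couplings_def P1 P2)
      moreover have "cost A (add_mset (u, v) P2) \<le> cost A P"
        using Metric_space.triangle[OF M uv(1) pq uv(2)] by (simp add: P1 P2 cost_def)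
      ultimately show ?thesis by (intro bexI[of _ "add_mset (u, v) P2"])
    qed
    then obtain P' where "P' \<in> couplings A \<alpha> \<beta>" "cost A P' \<le> cost A P" by blast
    then show "(INF P \<in> couplings A \<alpha> \<beta>. cost A P) \<le> cost A P"
      by (rule order_trans[OF cINF_lower[OF cost_bdd_below]])
  qed
qed

lemma W1_translate:
  assumes M: "Metric_space (quot A) (d1bar A)"
    and "\<alpha> \<in> diagrams A" "\<beta> \<in> diagrams A" "\<gamma> \<in> diagrams A"
  shows "W1 A (\<alpha> + \<gamma>) (\<beta> + \<gamma>) = W1 A \<alpha> \<beta>"
  using assms(4)
proof (induction \<gamma>)
  case (add p \<gamma>)
  then have "\<alpha> + \<gamma> \<in> diagrams A" "\<beta> + \<gamma> \<in> diagrams A" "p \<notin> A" "\<gamma> \<in> diagrams A"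
    using assms(2,3) by (auto simp: diagrams_def)
  then show ?case
    using W1_add_point[OF M] add.IH by simp
qed simp

lemma cls_add: "cls x (\<alpha> + \<beta>) = cls x \<alpha> + cls x \<beta>"
  by (simp add: cls_def vec_eq_iff)

lemma cls_inj:
  assumes "bij_betw x UNIV (- A)" "\<alpha> \<in> diagrams A" "\<beta> \<in> diagrams A" "cls x \<alpha> = cls x \<beta>"
  shows "\<alpha> = \<beta>"
proof (rule multiset_eqI)
  fix p
  show "count \<alpha> p = count \<beta> p"
  proof (cases "p \<in> A")
    case True
    then have "p \<notin># \<alpha>" "p \<notin># \<beta>"
      using assms(2,3) by (auto simp: diagrams_def)
    then show ?thesis by (simp add: not_in_iff)
  next
    case False
    then obtain j where "p = x j"
      using assms(1) by (auto simp: bij_betw_def)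
    then show ?thesis
      using assms(4) by (simp add: cls_def vec_eq_iff)
  qed
qed

lemma pos_diagram_in_diagrams:
  assumes "bij_betw x UNIV (- A)"
  shows "pos_diagram x u \<in> diagrams A"
  using assms by (auto simp: pos_diagram_def diagrams_def bij_betw_def set_mset_sum split: if_splits)

lemma cls_pos_diagram:
  assumes "inj x"
  shows "cls x (pos_diagram x u) $ j = max 0 (u $ j)"
proof -
  have "count (pos_diagram x u) (x j) = (\<Sum>i\<in>UNIV. if i = j then nat (u $ i) else 0)"
    unfolding pos_diagram_def count_sum
    by (rule sum.cong) (auto dest: injD[OF assms])
  then show ?thesis by (simp add: cls_def)
qed

theorem rho_cls:
  assumes M: "Metric_space (quot A) (d1bar A)" and x: "bij_betw x UNIV (- A)"
    and D: "a \<in> diagrams A" "b \<in> diagrams A" "c \<in> diagrams A" "e \<in> diagrams A"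
  shows "rho A x (cls x a - cls x b) (cls x c - cls x e) = W1 A (a + e) (c + b)"
proof -
  let ?u = "cls x a - cls x b" and ?v = "cls x c - cls x e"
  let ?p = "pos_diagram x"
  have add: "\<alpha> + \<beta> \<in> diagrams A" if "\<alpha> \<in> diagrams A" "\<beta> \<in> diagrams A" for \<alpha> \<beta>
    using that by (auto simp: diagrams_def)
  note mem = D add pos_diagram_in_diagrams[OF x]
  have inj: "inj x"
    using x by (simp add: bij_betw_def)
  have eq: "\<alpha> + ?p (- w) = \<beta> + ?p w"
    if "\<alpha> \<in> diagrams A" "\<beta> \<in> diagrams A" "w = cls x \<alpha> - cls x \<beta>" for \<alpha> \<beta> w
    by (rule cls_inj[OF x])
      (use that in \<open>auto simp: mem cls_add vec_eq_iff cls_pos_diagram[OF inj]\<close>)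
  have 1: "a + ?p (- ?u) = b + ?p ?u" and 2: "c + ?p (- ?v) = e + ?p ?v"
    by (rule eq; simp add: D)+
  have "W1 A (a + e) (c + b) = W1 A ((a + e) + (?p (- ?u) + ?p (- ?v))) ((c + b) + (?p (- ?u) + ?p (- ?v)))"
    by (rule W1_translate[OF M, symmetric]) (simp_all add: mem)
  also have "(a + e) + (?p (- ?u) + ?p (- ?v)) = (a + ?p (- ?u)) + e + ?p (- ?v)"
    by (simp only: ac_simps)
  also have "\<dots> = (?p ?u + ?p (- ?v)) + (b + e)"
    by (simp only: 1 ac_simps)
  also have "(c + b) + (?p (- ?u) + ?p (- ?v)) = (c + ?p (- ?v)) + b + ?p (- ?u)"
    by (simp only: ac_simps)
  also have "\<dots> = (?p ?v + ?p (- ?u)) + (b + e)"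
    by (simp only: 2 ac_simps)
  also have "W1 A ((?p ?u + ?p (- ?v)) + (b + e)) ((?p ?v + ?p (- ?u)) + (b + e)) = rho A x ?u ?v"
    unfolding rho_def by (rule W1_translate[OF M]) (simp_all add: mem)
  finally show ?thesis ..
qed

section \<open>The torus and its characters\<close>

definition torus_rel :: "real ^ 'n \<Rightarrow> real ^ 'n::finite \<Rightarrow> bool" where
  "torus_rel s t \<longleftrightarrow> (\<exists>k :: int ^ 'n. \<forall>j. s $ j - t $ j = 2 * pi * of_int (k $ j))"

quotient_type 'n torus = "real ^ 'n::finite" / torus_rel
proof (rule equivpI)
  show "reflp (torus_rel :: real ^ 'n \<Rightarrow> _)"
    unfolding torus_rel_def by (rule reflpI, rule exI[of _ 0]) simp
  show "symp (torus_rel :: real ^ 'n \<Rightarrow> _)"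
  proof (rule sympI)
    fix s t :: "real ^ 'n" assume "torus_rel s t"
    then obtain k :: "int ^ 'n" where "\<forall>j. s $ j - t $ j = 2 * pi * of_int (k $ j)"
      by (auto simp: torus_rel_def)
    then show "torus_rel t s"
      unfolding torus_rel_def by (intro exI[of _ "- k"]) (simp add: algebra_simps)
  qed
  show "transp (torus_rel :: real ^ 'n \<Rightarrow> _)"
  proof (rule transpI)
    fix s t r :: "real ^ 'n" assume "torus_rel s t" "torus_rel t r"
    then obtain k l :: "int ^ 'n" where "\<forall>j. s $ j - t $ j = 2 * pi * of_int (k $ j)"
      "\<forall>j. t $ j - r $ j = 2 * pi * of_int (l $ j)"
      by (auto simp: torus_rel_def)
    then show "torus_rel s r"
      unfolding torus_rel_def by (intro exI[of _ "k + l"]) (simp add: algebra_simps)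
  qed
qed

text \<open>The quotient topology.\<close>

instantiation torus :: (finite) topological_space
begin

definition open_torus :: "'a torus set \<Rightarrow> bool" where
  "open_torus U \<longleftrightarrow> open (abs_torus -` U)"

instance
  by standard (auto simp: open_torus_def vimage_Union)

end

lift_definition character :: "'n::finite torus \<Rightarrow> int ^ 'n \<Rightarrow> complex"
  is "\<lambda>\<theta> m. exp (\<i> * (\<Sum>j\<in>UNIV. of_int (m $ j) * of_real (\<theta> $ j)))"
proof (rule ext)
  fix s t :: "real ^ 'n" and m :: "int ^ 'n"
  assume "torus_rel s t"
  then obtain k :: "int ^ 'n" where k: "\<And>j. s $ j = t $ j + 2 * pi * of_int (k $ j)"
    by (auto simp: torus_rel_def algebra_simps)
  have "\<i> * (\<Sum>j\<in>UNIV. of_int (m $ j) * complex_of_real (s $ j))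
      = \<i> * (\<Sum>j\<in>UNIV. of_int (m $ j) * complex_of_real (t $ j))
        + 2 * of_int (\<Sum>j\<in>UNIV. m $ j * k $ j) * of_real pi * \<i>"
    by (simp add: k sum.distrib sum_distrib_left sum_distrib_right algebra_simps)
  then show "exp (\<i> * (\<Sum>j\<in>UNIV. of_int (m $ j) * complex_of_real (s $ j)))
      = exp (\<i> * (\<Sum>j\<in>UNIV. of_int (m $ j) * complex_of_real (t $ j)))"
    unfolding exp_eq by (intro exI[of _ "\<Sum>j\<in>UNIV. m $ j * k $ j"]) (simp add: mult.assoc)
qed

text \<open>The geodesic distance between two points of the unit circle in the complex plane.
  The infimum runs over all choices of arguments, which already includes their translates
  by multiples of \<open>2 * pi\<close>.\<close>

definition arc_dist :: "complex \<Rightarrow> complex \<Rightarrow> real" where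
  "arc_dist z w = Inf {\<bar>a - b\<bar> | a b. z = cis a \<and> w = cis b}"

lemma arc_dist_cis: "arc_dist (cis a) (cis b) = (INF k::int. \<bar>a - b + 2 * pi * of_int k\<bar>)"
proof -
  have "{\<bar>a' - b'\<bar> | a' b'. cis a = cis a' \<and> cis b = cis b'}
      = range (\<lambda>k::int. \<bar>a - b + 2 * pi * of_int k\<bar>)" (is "?L = ?R")
  proof (intro equalityI subsetI)
    fix y assume "y \<in> ?L"
    then obtain a' b' where y: "y = \<bar>a' - b'\<bar>" and "cis a = cis a'" "cis b = cis b'"
      by blast
    then obtain k l :: int where "a' = a + 2 * pi * of_int k" "b' = b + 2 * pi * of_int l"
      by (metis complex_eq_iff cis.sel sin_cos_eq_iff)
    then have "y = \<bar>a - b + 2 * pi * of_int (k - l)\<bar>"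
      by (simp add: y algebra_simps)
    then show "y \<in> ?R" by blast
  next
    fix y assume "y \<in> ?R"
    then obtain k :: int where y: "y = \<bar>a - b + 2 * pi * of_int k\<bar>" by blast
    have "cis a = cis (a + 2 * pi * of_int k)"
      by (metis complex_eq_iff cis.sel sin_cos_eq_iff)
    moreover have "y = \<bar>(a + 2 * pi * of_int k) - b\<bar>"
      by (simp add: y algebra_simps)
    ultimately show "y \<in> ?L" by blast
  qed
  then show ?thesis by (simp add: arc_dist_def)
qed

section \<open>Reproducing kernel Hilbert spaces\<close>

definition ip_norm :: "(('k \<Rightarrow> complex) \<Rightarrow> ('k \<Rightarrow> complex) \<Rightarrow> complex) \<Rightarrow> ('k \<Rightarrow> complex) \<Rightarrow> real" where
  "ip_norm ip f = sqrt (Re (ip f f))"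

text \<open>\<open>H\<close> with inner product \<open>ip\<close> (linear in the first argument) is the Hilbert space of
  functions on \<open>'k\<close> with reproducing kernel \<open>k\<close>.\<close>

locale rkhs =
  fixes k :: "'k \<Rightarrow> 'k \<Rightarrow> complex"
    and H :: "('k \<Rightarrow> complex) set"
    and ip :: "('k \<Rightarrow> complex) \<Rightarrow> ('k \<Rightarrow> complex) \<Rightarrow> complex"
  assumes zero_mem: "(\<lambda>\<alpha>. 0) \<in> H"
    and add_mem: "\<lbrakk>f \<in> H; g \<in> H\<rbrakk> \<Longrightarrow> (\<lambda>\<alpha>. f \<alpha> + g \<alpha>) \<in> H"
    and scale_mem: "f \<in> H \<Longrightarrow> (\<lambda>\<alpha>. c * f \<alpha>) \<in> H"
    and ip_add_left: "\<lbrakk>f \<in> H; g \<in> H; h \<in> H\<rbrakk> \<Longrightarrow> ip (\<lambda>\<alpha>. f \<alpha> + g \<alpha>) h = ip f h + ip g h"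
    and ip_scale_left: "\<lbrakk>f \<in> H; h \<in> H\<rbrakk> \<Longrightarrow> ip (\<lambda>\<alpha>. c * f \<alpha>) h = c * ip f h"
    and ip_commute: "\<lbrakk>f \<in> H; g \<in> H\<rbrakk> \<Longrightarrow> ip g f = cnj (ip f g)"
    and ip_nonneg: "f \<in> H \<Longrightarrow> 0 \<le> Re (ip f f)"
    and ip_definite: "\<lbrakk>f \<in> H; ip f f = 0\<rbrakk> \<Longrightarrow> f = (\<lambda>\<alpha>. 0)"
    and complete: "\<lbrakk>\<And>n. F n \<in> H;
        \<And>e. e > 0 \<Longrightarrow> \<exists>M. \<forall>m\<ge>M. \<forall>n\<ge>M. ip_norm ip (\<lambda>\<alpha>. F m \<alpha> - F n \<alpha>) < e\<rbrakk>
      \<Longrightarrow> \<exists>f\<in>H. (\<lambda>n. ip_norm ip (\<lambda>\<alpha>. F n \<alpha> - f \<alpha>)) \<longlonglongrightarrow> 0"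
    and kernel_mem: "(\<lambda>\<beta>. k \<beta> \<alpha>) \<in> H"
    and reproducing: "f \<in> H \<Longrightarrow> f \<alpha> = ip f (\<lambda>\<beta>. k \<beta> \<alpha>)"

definition char_kernel :: "'n::finite torus measure \<Rightarrow> int ^ 'n \<Rightarrow> int ^ 'n \<Rightarrow> complex" where
  "char_kernel \<nu> \<alpha> \<beta> = (LINT \<theta>|\<nu>. character \<theta> (\<alpha> - \<beta>))"

end

theory Submission
  imports Defs
begin

text \<open>By the reproducing property and Cauchy--Schwarz, \<open>|f \<alpha> - f \<beta>|\<close> is at most the norm of \<open>f\<close>
  times that of \<open>k(\<cdot>, \<alpha>) - k(\<cdot>, \<beta>)\<close>, whose square is the integral of
  \<open>|\<chi>\<^sub>\<theta> \<alpha> - \<chi>\<^sub>\<theta> \<beta>|\<^sup>2\<close> over \<open>\<theta>\<close>. Chords are shorter than arcs, so the integrand is at most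
  \<open>(Lip \<chi>\<^sub>\<theta> \<cdot> \<rho>(\<alpha>, \<beta>))\<^sup>2\<close>.\<close>

context rkhs
begin

lemma ip_add_right:
  assumes "f \<in> H" "g \<in> H" "h \<in> H"
  shows "ip h (\<lambda>\<alpha>. f \<alpha> + g \<alpha>) = ip h f + ip h g"
  using ip_add_left[OF assms] add_mem[OF assms(1,2)] assms
  by (simp add: ip_commute[of _ h])

lemma ip_scale_right:
  assumes "f \<in> H" "h \<in> H"
  shows "ip h (\<lambda>\<alpha>. c * f \<alpha>) = cnj c * ip h f"
  using ip_scale_left[OF assms] scale_mem[OF assms(1)] assms
  by (simp add: ip_commute[of _ h])

lemma diff_scale_mem:
  assumes "f \<in> H" "g \<in> H"
  shows "(\<lambda>\<alpha>. f \<alpha> - c * g \<alpha>) \<in> H"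
  using add_mem[OF assms(1) scale_mem[OF assms(2), of "- c"]] by simp

lemma ip_diff_scale_left:
  assumes "f \<in> H" "g \<in> H" "h \<in> H"
  shows "ip (\<lambda>\<alpha>. f \<alpha> - c * g \<alpha>) h = ip f h - c * ip g h"
  using ip_add_left[OF assms(1) scale_mem[OF assms(2), of "- c"] assms(3)]
    ip_scale_left[OF assms(2,3), of "- c"] by simp

lemma ip_diff_scale_right:
  assumes "f \<in> H" "g \<in> H" "h \<in> H"
  shows "ip h (\<lambda>\<alpha>. f \<alpha> - c * g \<alpha>) = ip h f - cnj c * ip h g"
  using ip_add_right[OF assms(1) scale_mem[OF assms(2), of "- c"] assms(3)]
    ip_scale_right[OF assms(2,3), of "- c"] by simp

lemma ip_self_eq:
  assumes "f \<in> H"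
  shows "ip f f = of_real ((ip_norm ip f)\<^sup>2)"
  using ip_commute[OF assms assms] ip_nonneg[OF assms]
  by (simp add: ip_norm_def complex_eq_iff)

theorem Cauchy_Schwarz_ineq:
  assumes f: "f \<in> H" and g: "g \<in> H"
  shows "norm (ip f g) \<le> ip_norm ip f * ip_norm ip g"
proof (cases "ip g g = 0")
  case True
  \<comment> \<open>By definiteness \<open>g\<close> is the zero function, hence equal to
    \<open>0 * g\<close>, so \<open>ip_scale_right\<close> at the scalar 0 applies.\<close>
  then have "ip f g = 0"
    using ip_definite[OF g] ip_scale_right[OF g f, of 0] by simp
  then show ?thesis
    using ip_nonneg f g by (simp add: ip_norm_def)
next
  case False
  define G where "G = (ip_norm ip g)\<^sup>2"
  have gg: "ip g g = of_real G"
    using ip_self_eq[OF g] by (simp add: G_def)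
  have G: "G > 0"
    using False gg by (auto simp: G_def)
  \<comment> \<open>\<open>c * g\<close> is the orthogonal projection of \<open>f\<close> onto the
    line of \<open>g\<close>. The inequality is the nonnegativity of the squared norm of the
    remainder \<open>h\<close>.\<close>
  define c where "c = ip f g / ip g g"
  define h where "h = (\<lambda>\<alpha>. f \<alpha> - c * g \<alpha>)"
  have h: "h \<in> H"
    unfolding h_def by (rule diff_scale_mem[OF f g])
  have "ip h g = 0"
    unfolding h_def ip_diff_scale_left[OF f g g] using False by (simp add: c_def)
  then have "ip h h = ip h f"
    using ip_diff_scale_right[OF f g h, of c] by (simp add: h_def[symmetric])
  also have "\<dots> = ip f f - c * ip g f"
    by (simp add: h_def ip_diff_scale_left f g)
  also have "c * ip g f = of_real ((norm (ip f g))\<^sup>2 / G)"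
    using ip_commute[OF f g] by (simp add: c_def gg complex_norm_square[symmetric])
  finally have "0 \<le> (ip_norm ip f)\<^sup>2 - (norm (ip f g))\<^sup>2 / G"
    using ip_nonneg[OF h] ip_self_eq[OF f] by simp
  then have "(norm (ip f g))\<^sup>2 \<le> (ip_norm ip f * ip_norm ip g)\<^sup>2"
    using G by (simp add: field_simps G_def)
  then show ?thesis
    by (rule power2_le_imp_le) (use ip_nonneg f g in \<open>simp add: ip_norm_def\<close>)
qed

lemma norm_diff_le:
  assumes "f \<in> H"
  shows "norm (f \<alpha> - f \<beta>) \<le> ip_norm ip f * sqrt (Re (k \<alpha> \<alpha> - k \<alpha> \<beta> - k \<beta> \<alpha> + k \<beta> \<beta>))"
proof -
  define g where "g = (\<lambda>\<gamma>. k \<gamma> \<alpha> - 1 * k \<gamma> \<beta>)"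
  have g: "g \<in> H"
    unfolding g_def by (rule diff_scale_mem[OF kernel_mem kernel_mem])
  \<comment> \<open>Used twice: at \<open>f\<close> for the difference to be bounded, and at
    \<open>g\<close> itself, where \<open>g \<alpha> - g \<beta>\<close> spells out the squared norm
    of \<open>g\<close> as four kernel values.\<close>
  have *: "ip h g = h \<alpha> - h \<beta>" if "h \<in> H" for h
    unfolding g_def ip_diff_scale_right[OF kernel_mem kernel_mem that]
    using reproducing[OF that] by simp
  show ?thesis
    using Cauchy_Schwarz_ineq[OF assms g] unfolding *[OF assms] ip_norm_def *[OF g]
    by (simp add: g_def algebra_simps)
qed

end

lemma continuous_abs_torus: "continuous_on UNIV abs_torus"
  by (simp add: continuous_on_open_vimage open_torus_def)

text \<open>In the quotient topology, continuity can be tested after composing with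
  \<open>abs_torus\<close>, where the character is an explicit exponential. This yields Borel
  measurability.\<close>

lemma continuous_character: "continuous_on UNIV (\<lambda>\<theta>. character \<theta> m)"
proof -
  have "continuous_on UNIV (\<lambda>t. character (abs_torus t) m)"
    unfolding character.abs_eq by (intro continuous_intros)
  then show ?thesis
    by (simp add: continuous_on_open_vimage open_torus_def vimage_def)
qed

lemma character_eq_cis:
  fixes m :: "int ^ 'n::finite"
  shows "\<exists>a. character \<theta> m = cis a"
proof (transfer fixing: m)
  fix t :: "real ^ 'n"
  show "\<exists>a. exp (\<i> * (\<Sum>j\<in>UNIV. of_int (m $ j) * complex_of_real (t $ j))) = cis a"
    by (intro exI[of _ "\<Sum>j\<in>UNIV. of_int (m $ j) * t $ j"]) (simp add: cis_conv_exp)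
qed

lemma norm_character [simp]: "norm (character \<theta> m) = 1"
  using character_eq_cis[of \<theta> m] by auto

lemma character_diff: "character \<theta> (m - n) = character \<theta> m * cnj (character \<theta> n)"
  by (transfer fixing: m n)
    (simp add: exp_cnj exp_add[symmetric] sum_subtractf algebra_simps)

lemma integrable_character:
  assumes "finite_measure \<nu>" "sets \<nu> = sets borel"
  shows "integrable \<nu> (\<lambda>\<theta>. character \<theta> m)"
proof (rule finite_measure.integrable_const_bound[OF assms(1), where B = 1])
  show "(\<lambda>\<theta>. character \<theta> m) \<in> borel_measurable \<nu>"
    using borel_measurable_continuous_onI[OF continuous_character]
    by (simp add: measurable_cong_sets[OF assms(2) refl])
qed simp

text \<open>Expand \<open>(z - w) * cnj (z - w)\<close>; by \<open>character_diff\<close> each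
  product is again a character value. The terms at \<open>\<alpha> - \<alpha>\<close> and
  \<open>\<beta> - \<beta>\<close> are not written as 1, so that the integral matches four values of
  \<open>char_kernel\<close>.\<close>

lemma character_chord_sq:
  "of_real ((norm (character \<theta> \<alpha> - character \<theta> \<beta>))\<^sup>2)
    = character \<theta> (\<alpha> - \<alpha>) - character \<theta> (\<alpha> - \<beta>) - character \<theta> (\<beta> - \<alpha>) + character \<theta> (\<beta> - \<beta>)"
  unfolding complex_norm_square character_diff by (simp add: algebra_simps)

lemma
  assumes "finite_measure \<nu>" "sets \<nu> = sets borel"
  shows integrable_chord_sq: "integrable \<nu> (\<lambda>\<theta>. (norm (character \<theta> \<alpha> - character \<theta> \<beta>))\<^sup>2)" (is ?I)
    and char_kernel_diff: "Re (char_kernel \<nu> \<alpha> \<alpha> - char_kernel \<nu> \<alpha> \<beta> - char_kernel \<nu> \<beta> \<alpha> + char_kernel \<nu> \<beta> \<beta>)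
      = (LINT \<theta>|\<nu>. (norm (character \<theta> \<alpha> - character \<theta> \<beta>))\<^sup>2)" (is ?E)
proof -
  note [simp] = integrable_character[OF assms]
  have "integrable \<nu> (\<lambda>\<theta>. complex_of_real ((norm (character \<theta> \<alpha> - character \<theta> \<beta>))\<^sup>2))"
    unfolding character_chord_sq by simp
  then show ?I
    by (rule complex_of_real_integrable_eq[THEN iffD1])
  have "char_kernel \<nu> \<alpha> \<alpha> - char_kernel \<nu> \<alpha> \<beta> - char_kernel \<nu> \<beta> \<alpha> + char_kernel \<nu> \<beta> \<beta>
    = (LINT \<theta>|\<nu>. complex_of_real ((norm (character \<theta> \<alpha> - character \<theta> \<beta>))\<^sup>2))"
    unfolding character_chord_sq by (simp add: char_kernel_def)
  then show ?E by (simp only: integral_complex_of_real Re_complex_of_real)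
qed

text \<open>After rotating by \<open>cis b\<close>, the chord has length
  \<open>2 * \<bar>sin ((a - b) / 2)\<bar>\<close>, and the sine is at most its argument in absolute
  value.\<close>

lemma dist_cis_le: "dist (cis a) (cis b) \<le> \<bar>a - b\<bar>"
proof -
  have "cis a - cis b = cis b * (exp (\<i> * of_real (a - b)) - 1)"
    by (simp add: cis_conv_exp exp_diff algebra_simps)
  then have "dist (cis a) (cis b) = norm (exp (\<i> * of_real (a - b)) - 1)"
    by (simp add: dist_norm norm_mult del: of_real_diff)
  also have "\<dots> \<le> \<bar>a - b\<bar>"
    using abs_sin_x_le_abs_x[of "(a - b) / 2"] unfolding dist_exp_i_1 by simp
  finally show ?thesis .
qed

lemma dist_le_arc_dist:
  assumes "norm z = 1" "norm w = 1"
  shows "dist z w \<le> arc_dist z w"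
  unfolding arc_dist_def
proof (rule cInf_greatest)
  \<comment> \<open>A lower bound passes to a real \<open>Inf\<close> only over a nonempty set; unit
    modulus supplies a pair of arguments.\<close>
  have "z = cis (Arg z)" "w = cis (Arg w)"
    using rcis_cmod_Arg[of z] rcis_cmod_Arg[of w] assms by (simp_all add: rcis_def)
  then show "{\<bar>a - b\<bar> |a b. z = cis a \<and> w = cis b} \<noteq> {}" by blast
qed (auto intro: dist_cis_le)

lemma Lip_upper:
  assumes "\<alpha> \<noteq> \<beta>"
  shows "ennreal (\<rho>2 (f \<alpha>) (f \<beta>) / \<rho>1 \<alpha> \<beta>) \<le> Lip \<rho>1 \<rho>2 f"
  unfolding Lip_def using assms by (intro SUP_upper2[of "(\<alpha>, \<beta>)"]) auto

text \<open>Lets the final bound be proved in squared form, under the integral, also when that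
  integral is infinite.\<close>

lemma ennreal_le_ennreal_sqrt:
  assumes "0 \<le> r" "ennreal (r\<^sup>2) \<le> t"
  shows "ennreal r \<le> ennreal_sqrt t"
proof (cases t)
  case (real s)
  then have "r\<^sup>2 \<le> s"
    using assms by simp
  then have "r \<le> sqrt s"
    using assms(1) real_le_rsqrt by blast
  then show ?thesis
    using real by (simp add: ennreal_sqrt_def)
qed (simp add: ennreal_sqrt_def)

theorem lemma5p1:
  fixes A :: "'a::metric_space set"
    and x :: "'n::finite \<Rightarrow> 'a"
    and \<nu> :: "'n torus measure"
    and H :: "(int ^ 'n \<Rightarrow> complex) set"
    and ip :: "(int ^ 'n \<Rightarrow> complex) \<Rightarrow> (int ^ 'n \<Rightarrow> complex) \<Rightarrow> complex"
    and f :: "int ^ 'n \<Rightarrow> complex"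
  assumes "A \<noteq> {}"
    and "bij_betw x UNIV (- A)"
    and "Metric_space (quot A) (d1bar A)"
    and "finite_measure \<nu>" and "sets \<nu> = sets borel"
    and "rkhs (char_kernel \<nu>) H ip"
    and "f \<in> H"
  shows "Lip (rho A x) dist f \<le> ennreal (ip_norm ip f) *
    ennreal_sqrt (\<integral>\<^sup>+\<theta>. (Lip (rho A x) arc_dist (character \<theta>))\<^sup>2 \<partial>\<nu>)"
    (is "_ \<le> _ * ennreal_sqrt ?J")
proof -
  interpret rkhs "char_kernel \<nu>" H ip by fact
  have "ennreal (dist (f \<alpha>) (f \<beta>) / rho A x \<alpha> \<beta>) \<le> ennreal (ip_norm ip f) * ennreal_sqrt ?J"
    if ne: "\<alpha> \<noteq> \<beta>" for \<alpha> \<beta>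
  proof (cases "rho A x \<alpha> \<beta> > 0")
    case False
    \<comment> \<open>A nonpositive denominator, including 0 with its default quotient 0, gives a
      quotient that \<open>ennreal\<close> sends to 0.\<close>
    then have "dist (f \<alpha>) (f \<beta>) / rho A x \<alpha> \<beta> \<le> 0"
      by (simp add: divide_nonneg_nonpos)
    then show ?thesis
      by (simp add: ennreal_neg)
  next
    case True
    define r where "r = rho A x \<alpha> \<beta>"
    define I where "I = (LINT \<theta>|\<nu>. (norm (character \<theta> \<alpha> - character \<theta> \<beta>))\<^sup>2)"
    have r: "r > 0"
      using True by (simp add: r_def)
    have I: "I \<ge> 0"
      by (simp add: I_def)
    have f0: "ip_norm ip f \<ge> 0"
      using ip_nonneg[OF \<open>f \<in> H\<close>] by (simp add: ip_norm_def)
    have "dist (f \<alpha>) (f \<beta>) \<le> ip_norm ip f * sqrt I"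
      using norm_diff_le[OF \<open>f \<in> H\<close>, of \<alpha> \<beta>]
      unfolding char_kernel_diff[OF assms(4,5)] by (simp add: dist_norm I_def)
    then have "dist (f \<alpha>) (f \<beta>) / r \<le> ip_norm ip f * (sqrt I / r)"
      using r by (simp add: divide_right_mono)
    then have "ennreal (dist (f \<alpha>) (f \<beta>) / r) \<le> ennreal (ip_norm ip f) * ennreal (sqrt I / r)"
      using f0 I r by (simp add: ennreal_mult[symmetric])
    also have "ennreal (sqrt I / r) \<le> ennreal_sqrt ?J"
    proof (rule ennreal_le_ennreal_sqrt)
      have "ennreal ((sqrt I / r)\<^sup>2) = ennreal (LINT \<theta>|\<nu>. (norm (character \<theta> \<alpha> - character \<theta> \<beta>) / r)\<^sup>2)"
        using I by (simp add: power_divide I_def)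
      \<comment> \<open>For the nonnegative integral, comparison is pointwise: the larger integrand
        may be infinite, and its measurability in \<theta> is not at issue.\<close>
      also have "\<dots> = (\<integral>\<^sup>+\<theta>. ennreal ((norm (character \<theta> \<alpha> - character \<theta> \<beta>) / r)\<^sup>2) \<partial>\<nu>)"
        by (rule nn_integral_eq_integral[symmetric])
          (simp_all add: power_divide integrable_chord_sq[OF assms(4,5)])
      also have "\<dots> \<le> ?J"
      proof (rule nn_integral_mono)
        fix \<theta> :: "'n torus"
        \<comment> \<open>The arc quotient at the fixed pair is one of the terms in the supremum
          defining \<open>Lip\<close>; squaring comes last.\<close>
        have "ennreal (norm (character \<theta> \<alpha> - character \<theta> \<beta>) / r)
            \<le> ennreal (arc_dist (character \<theta> \<alpha>) (character \<theta> \<beta>) / r)"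
          using dist_le_arc_dist[of "character \<theta> \<alpha>" "character \<theta> \<beta>"] r
          by (intro ennreal_leI divide_right_mono) (simp_all add: dist_norm)
        also have "\<dots> \<le> Lip (rho A x) arc_dist (character \<theta>)"
          unfolding r_def by (rule Lip_upper[OF ne])
        finally show "ennreal ((norm (character \<theta> \<alpha> - character \<theta> \<beta>) / r)\<^sup>2)
            \<le> (Lip (rho A x) arc_dist (character \<theta>))\<^sup>2"
          using r by (simp add: ennreal_power[symmetric] power_mono)
      qed
      finally show "ennreal ((sqrt I / r)\<^sup>2) \<le> ?J" .
    qed (use I r in simp)
    finally show ?thesis
      by (simp add: r_def mult_left_mono)
  qed
  then show ?thesis
    unfolding Lip_def[of "rho A x" dist] by (auto intro!: SUP_least)
qed

end
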